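(* Let $(X,\mathcal{E})$ be a quasi-coarse space. The following properties are equivalent: (a) there exists an extended quasi-metric $d\colon X\times X\to[0,\infty]$ on $X$ such that $\mathcal{E}=\mathcal{E}_d$; (b) there exists an extended quasi-metric space $(Y,d)$ such that $(Y,\mathcal{E}_d)$ is $\operatorname{Sym}$-coarsely equivalent to $(X,\mathcal{E})$; (c) $\operatorname{cf}\mathcal{E}\le\omega$.
   Context: For $E,F\subseteq X\times X$ put $E^{-1}=\{(x,y)\mid (y,x)\in E\}$, $E\circ F=\{(x,z)\mid \exists y\in X:\ (x,y)\in E,\ (y,z)\in F\}$, $\Delta_X=\{(x,x)\mid x\in X\}$. A quasi-coarse structure on $X$ is a family $\mathcal{E}$ of subsets of $X\times X$ closed under subsets and finite unions, with $\Delta_X\in\mathcal{E}$ and $E\circ F\in\mathcal{E}$ for all $E,F\in\mathcal{E}$; $(X,\mathcal{E})$ is then a quasi-coarse space. For a family $\mathcal{B}$ of sets, $\widehat{\mathcal{B}}$ is the family of all subsets of members of $\mathcal{B}$; the cofinality is $\operatorname{cf}\mathcal{E}=\inf\{|\mathcal{B}|\mid \widehat{\mathcal{B}}=\mathcal{E}\}$. An extended quasi-metric on $X$ is a map $d\colon X\times X\to[0,\infty]$ with $d(x,x)=0$, $d(x,y)\le d(x,z)+d(z,y)$ for all $x,y,z$, and $x=y$ whenever $d(x,y)=0$ (symmetry is not required). Put $\mathcal{E}_d=\widehat{\{E_R\mid R\ge0\}}$, where $E_R=\{(x,y)\mid d(x,y)\le R\}$; this is a quasi-coarse structure. For quasi-coarse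 spaces $(X,\mathcal{E}_X),(Y,\mathcal{E}_Y)$, a map $f\colon X\to Y$ is bornologous if $(f\times f)(E)\in\mathcal{E}_Y$ for every $E\in\mathcal{E}_X$. Put $\operatorname{Sym}(\mathcal{E})=\mathcal{E}\cap\{E^{-1}\mid E\in\mathcal{E}\}$. Two quasi-coarse spaces are $\operatorname{Sym}$-coarsely equivalent if there are bornologous maps $f\colon X\to Y$ and $g\colon Y\to X$ with $\{(g(f(x)),x)\mid x\in X\}\in\operatorname{Sym}(\mathcal{E}_X)$ and $\{(f(g(y)),y)\mid y\in Y\}\in\operatorname{Sym}(\mathcal{E}_Y)$. *)

theory Defs
  imports Complex_Main "HOL-Library.FuncSet" "HOL-Library.Extended_Nonnegative_Real"
begin

unbundle cardinal_syntax

text \<open>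
  Spaces are carrier sets together with a family of relations on them. The composition
  and inverse of entourages are \<^const>\<open>relcomp\<close> and \<^const>\<open>converse\<close>, the diagonal
  of \<open>X\<close> is \<open>Id_on X\<close>.
\<close>

locale quasi_coarse_space =
  fixes X :: "'a set" and \<E> :: "'a rel set"
  assumes entourage_subset: "E \<in> \<E> \<Longrightarrow> E \<subseteq> X \<times> X"
    and subset_closed: "E \<in> \<E> \<Longrightarrow> F \<subseteq> E \<Longrightarrow> F \<in> \<E>"
    and union_closed: "E \<in> \<E> \<Longrightarrow> F \<in> \<E> \<Longrightarrow> E \<union> F \<in> \<E>"
    and diagonal: "Id_on X \<in> \<E>"
    and relcomp_closed: "E \<in> \<E> \<Longrightarrow> F \<in> \<E> \<Longrightarrow> E O F \<in> \<E>"

definition downset :: "'a set set \<Rightarrow> 'a set set" where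
  "downset \<B> = {A. \<exists>B\<in>\<B>. A \<subseteq> B}"

text \<open>
  The cofinality is the least of the cardinals \<open>|\<B>|\<close>. In HOL cardinals are represented by
  well-order relations and are unique only up to \<open>=o\<close>; this is why \<open>SOME\<close> occurs here.
  A least element exists whenever some \<open>\<B>\<close> with \<open>downset \<B> = \<E>\<close> exists, see
  \<open>cofinality_least\<close> below. Since \<open>\<B> \<subseteq> downset \<B>\<close>, all relevant families \<open>\<B>\<close> are
  subfamilies of \<open>\<E>\<close>.
\<close>

definition cofinality :: "'a set set \<Rightarrow> 'a set rel" where
  "cofinality \<E> = (SOME \<kappa>. \<kappa> \<in> {|\<B>| |\<B>. downset \<B> = \<E>} \<and>
      (\<forall>\<kappa>' \<in> {|\<B>| |\<B>. downset \<B> = \<E>}. \<kappa> \<le>o \<kappa>'))"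

lemma cofinality_least:
  assumes "downset \<B>\<^sub>0 = \<E>"
  shows "cofinality \<E> \<in> {|\<B>| |\<B>. downset \<B> = \<E>}"
    and "downset \<B> = \<E> \<Longrightarrow> cofinality \<E> \<le>o |\<B>|"
proof -
  let ?R = "{|\<B>| |\<B>. downset \<B> = \<E>}"
  have "?R \<noteq> {}" and "\<forall>\<kappa>\<in>?R. Card_order \<kappa>"
    using assms card_of_Card_order by blast+
  then have "\<exists>\<kappa>. \<kappa> \<in> ?R \<and> (\<forall>\<kappa>'\<in>?R. \<kappa> \<le>o \<kappa>')"
    using exists_minim_Card_order[of ?R] by blast
  then have *: "cofinality \<E> \<in> ?R \<and> (\<forall>\<kappa>'\<in>?R. cofinality \<E> \<le>o \<kappa>')"
    unfolding cofinality_def by (rule someI_ex)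
  then show "cofinality \<E> \<in> ?R" by (rule conjunct1)
  show "cofinality \<E> \<le>o |\<B>|" if "downset \<B> = \<E>"
    using * that by blast
qed

lemma (in quasi_coarse_space) downset_eq: "downset \<E> = \<E>"
  unfolding downset_def using subset_closed by blast

text \<open>Only the values of \<open>d\<close> on \<open>X \<times> X\<close> are relevant.\<close>

locale extended_quasi_metric_space =
  fixes X :: "'a set" and d :: "'a \<Rightarrow> 'a \<Rightarrow> ennreal"
  assumes refl: "x \<in> X \<Longrightarrow> d x x = 0"
    and triangle: "x \<in> X \<Longrightarrow> y \<in> X \<Longrightarrow> z \<in> X \<Longrightarrow> d x y \<le> d x z + d z y"
    and separated: "x \<in> X \<Longrightarrow> y \<in> X \<Longrightarrow> d x y = 0 \<Longrightarrow> x = y"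

text \<open>The radius \<open>R\<close> is a (finite) real number, although \<open>d\<close> may take the value \<open>\<infinity>\<close>.\<close>

definition metric_entourage :: "'a set \<Rightarrow> ('a \<Rightarrow> 'a \<Rightarrow> ennreal) \<Rightarrow> real \<Rightarrow> 'a rel" where
  "metric_entourage X d R = {(x, y). x \<in> X \<and> y \<in> X \<and> d x y \<le> ennreal R}"

definition metric_structure :: "'a set \<Rightarrow> ('a \<Rightarrow> 'a \<Rightarrow> ennreal) \<Rightarrow> 'a rel set" where
  "metric_structure X d = downset {metric_entourage X d R |R. R \<ge> 0}"

lemma (in extended_quasi_metric_space) quasi_coarse_space_metric_structure:
  "quasi_coarse_space X (metric_structure X d)"
proof
  let ?E = "metric_entourage X d"
  have iff: "E \<in> metric_structure X d \<longleftrightarrow> (\<exists>R\<ge>0. E \<subseteq> ?E R)" for E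
    unfolding metric_structure_def downset_def by blast
  have mono: "?E R \<subseteq> ?E S" if "R \<le> S" for R S
    unfolding metric_entourage_def using ennreal_leI[OF that] by (auto intro: order_trans)
  show "E \<subseteq> X \<times> X" if "E \<in> metric_structure X d" for E
    using that unfolding iff metric_entourage_def by blast
  show "F \<in> metric_structure X d" if "E \<in> metric_structure X d" "F \<subseteq> E" for E F
    using that unfolding iff by blast
  show "Id_on X \<in> metric_structure X d"
    unfolding iff by (rule exI[of _ 0]) (auto simp: metric_entourage_def refl)
  fix E F assume "E \<in> metric_structure X d" "F \<in> metric_structure X d"
  then obtain R S where R: "R \<ge> 0" "E \<subseteq> ?E R" and S: "S \<ge> 0" "F \<subseteq> ?E S"
    unfolding iff by blast
  have "E \<union> F \<subseteq> ?E (max R S)"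
    using R S mono[of R "max R S"] mono[of S "max R S"] by auto
  then show "E \<union> F \<in> metric_structure X d"
    unfolding iff using R(1) by (intro exI[of _ "max R S"]) auto
  have "?E R O ?E S \<subseteq> ?E (R + S)"
  proof clarify
    fix x y z assume xy: "(x, y) \<in> ?E R" and yz: "(y, z) \<in> ?E S"
    then have "d x z \<le> d x y + d y z"
      unfolding metric_entourage_def by (auto intro: triangle)
    also have "\<dots> \<le> ennreal R + ennreal S"
      using xy yz unfolding metric_entourage_def by (auto intro: add_mono)
    finally show "(x, z) \<in> ?E (R + S)"
      using xy yz R(1) S(1) unfolding metric_entourage_def by auto
  qed
  then have "E O F \<subseteq> ?E (R + S)"
    using relcomp_mono[OF R(2) S(2)] by (rule order_trans[rotated])
  then show "E O F \<in> metric_structure X d"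
    unfolding iff using R(1) S(1) by (intro exI[of _ "R + S"]) auto
qed

definition bornologous ::
  "'a set \<Rightarrow> 'a rel set \<Rightarrow> 'b set \<Rightarrow> 'b rel set \<Rightarrow> ('a \<Rightarrow> 'b) \<Rightarrow> bool" where
  "bornologous X \<E>\<^sub>X Y \<E>\<^sub>Y f \<longleftrightarrow> f \<in> X \<rightarrow> Y \<and> (\<forall>E\<in>\<E>\<^sub>X. map_prod f f ` E \<in> \<E>\<^sub>Y)"

definition Sym :: "'a rel set \<Rightarrow> 'a rel set" where
  "Sym \<E> = \<E> \<inter> {E\<inverse> |E. E \<in> \<E>}"

definition Sym_coarsely_equivalent ::
  "'a set \<Rightarrow> 'a rel set \<Rightarrow> 'b set \<Rightarrow> 'b rel set \<Rightarrow> bool" where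
  "Sym_coarsely_equivalent X \<E>\<^sub>X Y \<E>\<^sub>Y \<longleftrightarrow>
    (\<exists>f g. bornologous X \<E>\<^sub>X Y \<E>\<^sub>Y f \<and> bornologous Y \<E>\<^sub>Y X \<E>\<^sub>X g \<and>
      {(g (f x), x) |x. x \<in> X} \<in> Sym \<E>\<^sub>X \<and> {(f (g y), y) |y. y \<in> Y} \<in> Sym \<E>\<^sub>Y)"

text \<open>
  HOL cannot quantify over types inside a formula, so the existence of an extended quasi-metric
  space Sym-coarsely equivalent to \<open>(X, \<E>)\<close> depends on the type in which the carrier of that
  space lives; the type is passed as the first argument. If a space exists in some type,
  then it exists in every type into which that type embeds.
\<close>

definition Sym_equivalent_to_metric :: "'b itself \<Rightarrow> 'a set \<Rightarrow> 'a rel set \<Rightarrow> bool" where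
  "Sym_equivalent_to_metric (_ :: 'b itself) X \<E> \<longleftrightarrow>
    (\<exists>(Y :: 'b set) d. extended_quasi_metric_space Y d \<and>
      Sym_coarsely_equivalent Y (metric_structure Y d) X \<E>)"

end

theory Submission
  imports Defs "HOL-Library.Countable_Set_Type"
begin

text \<open>
  A countable base \<open>b\<close> of \<open>\<E>\<close> is turned into a chain \<open>F\<close> of entourages starting with the
  diagonal, absorbing every \<open>b n\<close> and satisfying \<open>F n O F n \<subseteq> F (Suc n)\<close>; then
  \<open>d x y = min {n. (x, y) \<in> F n}\<close> induces \<open>\<E>\<close>. Conversely, \<open>\<E>\<^sub>d\<close> has the balls of integer
  radius as a countable base, and a countable base can be transported along a
  \<open>Sym\<close>-coarse equivalence: with \<open>P = {(f (g x), x)}\<close>, every \<open>E \<in> \<E>\<close> lies in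
  \<open>P\<inverse> O (f \<times> f) ((g \<times> g) E) O P\<close>.
\<close>

text \<open>Radii can be rounded up to integers, so countably many balls suffice as a base of the
  metric structure.\<close>

lemma mem_metric_structure_iff_nat:
  "E \<in> metric_structure X d \<longleftrightarrow> (\<exists>n. E \<subseteq> metric_entourage X d (real n))"
proof
  assume "E \<in> metric_structure X d"
  then obtain R where "E \<subseteq> metric_entourage X d R"
    unfolding metric_structure_def downset_def by blast
  moreover obtain n where "R \<le> real n" using real_arch_simple by blast
  then have "metric_entourage X d R \<subseteq> metric_entourage X d (real n)"
    unfolding metric_entourage_def by (auto intro: order_trans ennreal_leI)
  ultimately show "\<exists>n. E \<subseteq> metric_entourage X d (real n)" by blast
next
  assume "\<exists>n. E \<subseteq> metric_entourage X d (real n)"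
  then show "E \<in> metric_structure X d"
    unfolding metric_structure_def downset_def using of_nat_0_le_iff by blast
qed

context quasi_coarse_space
begin

lemma downset_range_eqI:
  assumes mem: "\<And>i. b i \<in> \<E>" and cover: "\<And>E. E \<in> \<E> \<Longrightarrow> \<exists>i. E \<subseteq> b i"
  shows "downset (range b) = \<E>"
proof
  show "downset (range b) \<subseteq> \<E>"
    using mem by (auto simp: downset_def intro: subset_closed)
  show "\<E> \<subseteq> downset (range b)"
    using cover by (auto simp: downset_def)
qed

text \<open>A base is never empty, because some member must contain the diagonal. Hence even a
  finite one can be enumerated by all of \<open>nat\<close>, with repetitions.\<close>

lemma cofinality_le_natLeq_iff:
  "cofinality \<E> \<le>o natLeq \<longleftrightarrow> (\<exists>b :: nat \<Rightarrow> 'a rel. downset (range b) = \<E>)"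
proof
  assume le: "cofinality \<E> \<le>o natLeq"
  obtain \<B> where \<B>: "cofinality \<E> = |\<B>|" "downset \<B> = \<E>"
    using cofinality_least(1)[OF downset_eq] by blast
  have "\<B> \<noteq> {}" using diagonal \<B>(2) unfolding downset_def by blast
  moreover have "countable \<B>" using le \<B>(1) by (simp add: countable_card_le_natLeq)
  ultimately have "range (from_nat_into \<B>) = \<B>" by (rule range_from_nat_into)
  then show "\<exists>b :: nat \<Rightarrow> 'a rel. downset (range b) = \<E>" using \<B>(2) by metis
next
  assume "\<exists>b :: nat \<Rightarrow> 'a rel. downset (range b) = \<E>"
  then obtain b :: "nat \<Rightarrow> 'a rel" where b: "downset (range b) = \<E>" by blast
  have "|range b| \<le>o natLeq" by (simp flip: countable_card_le_natLeq)
  then show "cofinality \<E> \<le>o natLeq"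
    using cofinality_least(2)[OF b b] ordLeq_transitive by blast
qed

lemma chain_metrizable:
  fixes F :: "nat \<Rightarrow> 'a rel"
  assumes F0: "F 0 = Id_on X"
    and mono: "mono F"
    and comp: "\<And>n. F n O F n \<subseteq> F (Suc n)"
    and base: "downset (range F) = \<E>"
  shows "\<exists>d. extended_quasi_metric_space X d \<and> \<E> = metric_structure X d"
proof -
  define d :: "'a \<Rightarrow> 'a \<Rightarrow> ennreal"
    \<comment> \<open>The infimum of the empty set is the top element, so pairs lying in no
      \<open>F n\<close> get distance infinity.\<close>
    where "d x y = (INF n\<in>{n. (x, y) \<in> F n}. of_nat n)" for x y
  have F_sub: "F n \<subseteq> X \<times> X" for n
    using entourage_subset base unfolding downset_def by blast
  have d_le: "d x y \<le> of_nat n \<longleftrightarrow> (x, y) \<in> F n" for x y n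
  proof
    assume "d x y \<le> of_nat n"
    \<comment> \<open>A strict bound is what yields a witness \<open>m\<close> below the infimum;
      \<open>m < Suc n\<close> then gives \<open>m \<le> n\<close>.\<close>
    also have "(of_nat n :: ennreal) < of_nat (Suc n)"
      by (simp only: of_nat_less_iff lessI)
    finally obtain m where "(x, y) \<in> F m" "(of_nat m :: ennreal) < of_nat (Suc n)"
      unfolding d_def INF_less_iff by blast
    then show "(x, y) \<in> F n"
      using monoD[OF mono, of m n] by (auto simp del: of_nat_Suc)
  qed (auto simp: d_def intro: INF_lower)
  \<comment> \<open>Where finite, the infimum is attained by well-ordering, so the triangle
    inequality reduces to natural numbers.\<close>
  have d_cases: "d x y = \<infinity> \<or> (\<exists>n. d x y = of_nat n)" for x y
  proof (cases "\<exists>n. (x, y) \<in> F n")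
    case True
    let ?m = "LEAST n. (x, y) \<in> F n"
    have "of_nat ?m \<le> d x y"
      unfolding d_def by (rule INF_greatest) (auto intro: Least_le)
    moreover have "d x y \<le> of_nat ?m" unfolding d_le using True by (metis LeastI_ex)
    ultimately show ?thesis using antisym by blast
  qed (simp add: d_def)
  have "extended_quasi_metric_space X d"
  proof
    show "d x x = 0" if "x \<in> X" for x
      using d_le[of x x 0] F0 that by (simp add: Id_on_iff)
    show "x = y" if "d x y = 0" for x y
      using d_le[of x y 0] F0 that by auto
    fix x y z assume X: "x \<in> X" "y \<in> X" "z \<in> X"
    show "d x y \<le> d x z + d z y"
    proof (cases "d x z = \<infinity> \<or> d z y = \<infinity>")
      case False
      then obtain m n where mn: "d x z = of_nat m" "d z y = of_nat n"
        using d_cases by metis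
      have xz: "(x, z) \<in> F m" and zy: "(z, y) \<in> F n"
        using mn d_le[of x z m] d_le[of z y n] by simp_all
      have "(x, y) \<in> F (m + n)"
      \<comment> \<open>If one distance is 0, two points coincide because \<open>F 0\<close> is the
        diagonal. Otherwise \<open>Suc (max m n) \<le> m + n\<close>, so a single squaring step
        stays within the sum of the distances.\<close>
      proof (cases "m = 0 \<or> n = 0")
        case True
        then show ?thesis using xz zy F0 by auto
      next
        case False
        have "(x, z) \<in> F (max m n)" "(z, y) \<in> F (max m n)"
          using xz zy monoD[OF mono, of m "max m n"] monoD[OF mono, of n "max m n"] by auto
        then have "(x, y) \<in> F (Suc (max m n))" using comp by blast
        moreover have "Suc (max m n) \<le> m + n" using False by auto
        then have "F (Suc (max m n)) \<subseteq> F (m + n)" by (rule monoD[OF mono])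
        ultimately show ?thesis by blast
      qed
      then show ?thesis using mn d_le[of x y "m + n"] by simp
    qed auto
  qed
  moreover have "metric_entourage X d (real n) = F n" for n
    using F_sub[of n] d_le[of _ _ n]
    unfolding metric_entourage_def by (auto simp: ennreal_of_nat_eq_real_of_nat)
  then have "E \<in> metric_structure X d \<longleftrightarrow> E \<in> downset (range F)" for E
    by (simp add: mem_metric_structure_iff_nat downset_def)
  then have "\<E> = metric_structure X d"
    using base by auto
  ultimately show ?thesis by blast
qed

lemma countable_base_metrizable:
  fixes b :: "nat \<Rightarrow> 'a rel"
  assumes base: "downset (range b) = \<E>"
  shows "\<exists>d. extended_quasi_metric_space X d \<and> \<E> = metric_structure X d"
proof -
  \<comment> \<open>Adjoining \<open>b n\<close> before squaring makes the chain cofinal. As each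
    \<open>F n\<close> contains the diagonal, squaring only enlarges.\<close>
  define F where "F = rec_nat (Id_on X) (\<lambda>n A. (A \<union> b n) O (A \<union> b n))"
  have F0: "F 0 = Id_on X" and FS: "F (Suc n) = (F n \<union> b n) O (F n \<union> b n)" for n
    by (simp_all add: F_def)
  have b: "b n \<in> \<E>" for n using base unfolding downset_def by blast
  have F: "F n \<in> \<E>" for n
    by (induction n) (simp_all add: F0 FS b diagonal union_closed relcomp_closed)
  have Id: "Id_on X \<subseteq> F n" for n
    by (induction n) (auto simp: F0 FS)
  have sub: "F n \<union> b n \<subseteq> F (Suc n)" for n
    using Id[of n] entourage_subset[OF F[of n]] entourage_subset[OF b[of n]]
    unfolding FS by blast
  have "\<exists>n. E \<subseteq> F n" if "E \<in> \<E>" for E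
    using that sub unfolding base[symmetric] downset_def by blast
  with F have "downset (range F) = \<E>" by (rule downset_range_eqI)
  moreover have "mono F" using sub by (auto intro: incseq_SucI)
  moreover have "F n O F n \<subseteq> F (Suc n)" for n unfolding FS by blast
  ultimately show ?thesis using F0 chain_metrizable by metis
qed

text \<open>The base is indexed by integer radii and consists of relations on \<open>X\<close>, so
  neither the type nor the size of \<open>Y\<close> matters.\<close>

lemma Sym_equivalent_countable_base:
  assumes "Sym_equivalent_to_metric TYPE('b) X \<E>"
  shows "\<exists>b :: nat \<Rightarrow> 'a rel. downset (range b) = \<E>"
proof -
  obtain Y :: "'b set" and d f g
    where f: "bornologous Y (metric_structure Y d) X \<E> f"
      and g: "bornologous X \<E> Y (metric_structure Y d) g"
      and Sym: "{(f (g x), x) |x. x \<in> X} \<in> Sym \<E>"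
    using assms unfolding Sym_equivalent_to_metric_def Sym_coarsely_equivalent_def by blast
  define P where "P = {(f (g x), x) |x. x \<in> X}"
  define b where "b n = P\<inverse> O map_prod f f ` metric_entourage Y d (real n) O P" for n
  \<comment> \<open>This is where \<open>Sym\<close> enters: sandwiching requires both
    \<open>P\<close> and its converse to be entourages.\<close>
  have P: "P \<in> \<E>" "P\<inverse> \<in> \<E>" using Sym unfolding P_def[symmetric] Sym_def by auto
  have "map_prod f f ` metric_entourage Y d (real n) \<in> \<E>" for n
    using f mem_metric_structure_iff_nat unfolding bornologous_def by blast
  then have "b n \<in> \<E>" for n
    unfolding b_def by (intro relcomp_closed P)
  moreover have "\<exists>n. E \<subseteq> b n" if E: "E \<in> \<E>" for E
  proof -
    obtain n where n: "map_prod g g ` E \<subseteq> metric_entourage Y d (real n)"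
      using g E mem_metric_structure_iff_nat unfolding bornologous_def by blast
    have "(x, y) \<in> b n" if xy: "(x, y) \<in> E" for x y
    proof -
      have "(x, f (g x)) \<in> P\<inverse>" "(f (g y), y) \<in> P"
        using xy entourage_subset[OF E] unfolding P_def by auto
      moreover have "(f (g x), f (g y)) \<in> map_prod f f ` metric_entourage Y d (real n)"
        using n xy by force
      ultimately show ?thesis unfolding b_def by (intro relcompI)
    qed
    then have "E \<subseteq> b n" by (rule subrelI)
    then show ?thesis ..
  qed
  ultimately have "downset (range b) = \<E>" by (rule downset_range_eqI)
  then show ?thesis by blast
qed

text \<open>The identity serves in both directions. This lets a metrizable \<open>X\<close> be its
  own metric model.\<close>

lemma Sym_coarsely_equivalent_refl: "Sym_coarsely_equivalent X \<E> X \<E>"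
proof -
  have "{(x, x) |x. x \<in> X} = Id_on X" by auto
  moreover have "Id_on X \<in> Sym \<E>" unfolding Sym_def using diagonal by force
  moreover have "bornologous X \<E> X \<E> id" by (simp add: bornologous_def prod.map_id0)
  ultimately show ?thesis
    unfolding Sym_coarsely_equivalent_def by (intro exI[of _ id]) simp
qed

end

(* 'b is an arbitrary type: the last conjunct covers spaces Y of any type (and size) whatsoever *)
theorem theorem4p8:
  fixes X :: "'a set" and \<E> :: "'a rel set"
  assumes "quasi_coarse_space X \<E>"
  shows "((\<exists>d. extended_quasi_metric_space X d \<and> \<E> = metric_structure X d)
            \<longleftrightarrow> Sym_equivalent_to_metric TYPE('a) X \<E>)
       \<and> (Sym_equivalent_to_metric TYPE('a) X \<E> \<longleftrightarrow> cofinality \<E> \<le>o natLeq)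
       \<and> (Sym_equivalent_to_metric TYPE('b) X \<E> \<longrightarrow>
            (\<exists>d. extended_quasi_metric_space X d \<and> \<E> = metric_structure X d))"
proof -
  interpret quasi_coarse_space X \<E> by (fact assms)
  let ?a = "\<exists>d. extended_quasi_metric_space X d \<and> \<E> = metric_structure X d"
  let ?c = "cofinality \<E> \<le>o natLeq"
  have "Sym_equivalent_to_metric TYPE('a) X \<E>" if ?a
    using that Sym_coarsely_equivalent_refl unfolding Sym_equivalent_to_metric_def by metis
  moreover have "?c" if "Sym_equivalent_to_metric TYPE('a) X \<E>"
    using Sym_equivalent_countable_base[OF that] by (simp only: cofinality_le_natLeq_iff)
  moreover have "?c" if "Sym_equivalent_to_metric TYPE('b) X \<E>"
    using Sym_equivalent_countable_base[OF that] by (simp only: cofinality_le_natLeq_iff)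
  moreover have ?a if ?c
    using that countable_base_metrizable unfolding cofinality_le_natLeq_iff by blast
  ultimately show ?thesis by blast
qed

end
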